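(* Let $(f,x_0)$ be a $(\mathcal C_M,R_x)$-input for some real $M>0$ and $R_x\ge0$. If $x_N$ is an output of the SSEP-based subgradient method given $f$, $x_0$ and $N\in\mathbb N$, then $$f(x_N)-f_*\le\frac{MR_x}{\sqrt{N+1}}.$$
   Context: $\|\cdot\|$ is the Euclidean norm on $\mathbb R^d$; $\mathbb N$ denotes the positive integers; $f_*:=\min f$. $\mathcal C_M=\mathcal C_M(\mathbb R^d)$ is the class of (Lipschitz) closed, convex and proper functions $f$ on $\mathbb R^d$ such that $\|g\|\le M$ for all $x\in\mathbb R^d$ and all $g\in\partial f(x)$. $(f,x_0)$ is a $(\mathcal C_M,R_x)$-input if $f\in\mathcal C_M(\mathbb R^d)$, $x_0\in\mathbb R^d$ and $\|x_0-x_*\|\le R_x$ for some $x_*\in\operatorname{argmin}f$. SSEP-based subgradient method (input $f,x_0,N$, with $M,R_x$ known): for $i=1,\dots,N$ set $$y_i=\frac{i}{i+1}x_{i-1}+\frac1{i+1}x_0,\qquad d_i=\frac1{i+1}\sum_{j=0}^{i-1}f'(x_j),\qquad x_i=y_i-\frac{R_x}{M\sqrt{N+1}}\,d_i,$$ where $f'(x_j)\in\partial f(x_j)$ is an arbitrary subgradient chosen at $x_j$. The output is $x_N$. *)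

theory Defs
  imports "HOL-Analysis.Analysis"
begin

(* Convex-analytic notions for functions with values in (-infinity, +infinity], modelled as
   ereal-valued functions. Finiteness on the whole space is not assumed. *)

definition epi :: "(real ^ 'd \<Rightarrow> ereal) \<Rightarrow> ((real ^ 'd) \<times> real) set" where
  "epi f = {(x, t). f x \<le> ereal t}"

definition proper_fun :: "(real ^ 'd \<Rightarrow> ereal) \<Rightarrow> bool" where
  "proper_fun f \<longleftrightarrow> (\<forall>x. f x \<noteq> -\<infinity>) \<and> (\<exists>x. f x \<noteq> \<infinity>)"

definition convex_fun :: "(real ^ 'd \<Rightarrow> ereal) \<Rightarrow> bool" where
  "convex_fun f \<longleftrightarrow> convex (epi f)"

definition closed_fun :: "(real ^ 'd \<Rightarrow> ereal) \<Rightarrow> bool" where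
  "closed_fun f \<longleftrightarrow> closed (epi f)"

(* For proper f this is empty at every x with f x = \<infinity>, as usual. *)
definition subdifferential :: "(real ^ 'd \<Rightarrow> ereal) \<Rightarrow> real ^ 'd \<Rightarrow> (real ^ 'd) set" where
  "subdifferential f x = {g. \<forall>y. f x + ereal (g \<bullet> (y - x)) \<le> f y}"

definition class_C :: "real \<Rightarrow> (real ^ 'd \<Rightarrow> ereal) set" where
  "class_C M = {f. closed_fun f \<and> convex_fun f \<and> proper_fun f \<and>
                   (\<forall>x. \<forall>g\<in>subdifferential f x. norm g \<le> M)}"

definition argmin_set :: "(real ^ 'd \<Rightarrow> ereal) \<Rightarrow> (real ^ 'd) set" where
  "argmin_set f = {x. is_arg_min f (\<lambda>_. True) x}"

(* An infimum; it is the minimum of f whenever argmin_set f is nonempty. *)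
definition min_value :: "(real ^ 'd \<Rightarrow> ereal) \<Rightarrow> ereal" where
  "min_value f = (INF x. f x)"

definition C_input :: "real \<Rightarrow> real \<Rightarrow> (real ^ 'd \<Rightarrow> ereal) \<Rightarrow> real ^ 'd \<Rightarrow> bool" where
  "C_input M R f x0 \<longleftrightarrow> f \<in> class_C M \<and> (\<exists>xs\<in>argmin_set f. norm (x0 - xs) \<le> R)"

(* x is the sequence of iterates and g j is the subgradient chosen at x j;
   only x 0, ..., x N and g 0, ..., g (N - 1) are constrained. *)
definition ssep_run ::
  "real \<Rightarrow> real \<Rightarrow> (real ^ 'd \<Rightarrow> ereal) \<Rightarrow> real ^ 'd \<Rightarrow> nat \<Rightarrow>
   (nat \<Rightarrow> real ^ 'd) \<Rightarrow> (nat \<Rightarrow> real ^ 'd) \<Rightarrow> bool" where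
  "ssep_run M R f x0 N x g \<longleftrightarrow>
     x 0 = x0 \<and>
     (\<forall>j<N. g j \<in> subdifferential f (x j)) \<and>
     (\<forall>i\<in>{1..N}.
        let y = (real i / (real i + 1)) *\<^sub>R x (i - 1) + (1 / (real i + 1)) *\<^sub>R x0;
            d = (1 / (real i + 1)) *\<^sub>R (\<Sum>j<i. g j)
        in x i = y - (R / (M * sqrt (real N + 1))) *\<^sub>R d)"

definition ssep_output ::
  "real \<Rightarrow> real \<Rightarrow> (real ^ 'd \<Rightarrow> ereal) \<Rightarrow> real ^ 'd \<Rightarrow> nat \<Rightarrow> real ^ 'd \<Rightarrow> bool" where
  "ssep_output M R f x0 N xN \<longleftrightarrow> (\<exists>x g. ssep_run M R f x0 N x g \<and> xN = x N)"

end

theory Submission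
  imports Defs
begin

text \<open>
  The rate comes from adding subgradient inequalities. Let \<open>h = R / (M sqrt (N + 1))\<close>,
  let \<open>xs\<close> be a minimiser within distance \<open>R\<close> of \<open>x 0\<close>, and let \<open>S\<close> be the sum of
  \<open>g 0, ..., g N\<close>. At \<open>x i\<close> use the inequality towards \<open>xs\<close> with weight \<open>1\<close> and the one towards
  \<open>x (i - 1)\<close> with weight \<open>i\<close>. The method is designed so that the combination of points that
  then appears, \<open>xs + i x (i - 1) - (i + 1) x i\<close>, equals \<open>xs - x 0 + h (g 0 + ... + g (i - 1))\<close>.
  Hence the function values telescope over \<open>i\<close>, and the inner products of distinct subgradients
  assemble into half of \<open>norm S ^ 2\<close> minus half of the sum of the \<open>norm (g i) ^ 2\<close>
  (\<open>averaged_subgradient_telescoping\<close>). What remains is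
  \<open>(N + 1) (f (x N) - f xs) \<le> S \<bullet> (x 0 - xs) - h / 2 * norm S ^ 2 + h / 2 * (N + 1) M^2\<close>,
  and maximising the right-hand side over \<open>S\<close> gives \<open>M R sqrt (N + 1)\<close>.

  The sum runs up to \<open>i = N\<close>, so it needs a subgradient at \<open>x N\<close>, a point where the method
  chooses none and where \<open>f\<close> is not known in advance to be finite. Lemma \<open>subdifferential_nonempty\<close> supplies
  it: the proximal points of any \<open>x\<close> carry subgradients proportional to their displacement
  from \<open>x\<close>. As all subgradients are bounded by \<open>M\<close>, the proximal points converge to \<open>x\<close> while the
  regularisation vanishes, and since the epigraph is closed, a limit of their subgradients is a
  subgradient at \<open>x\<close>.
\<close>

section \<open>Existence of subgradients\<close>

text \<open>
  The proximal point \<open>p\<close> of \<open>x\<close> minimises \<open>f z + c / 2 * norm (z - x) ^ 2\<close>. Minimising over the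
  epigraph instead, a closed set, replaces lower semicontinuity of \<open>f\<close> by continuity of the
  objective; the lower bound on \<open>f\<close> makes the sublevel sets compact. The first-order optimality
  condition, read off along segments starting at \<open>p\<close>, is the subgradient inequality.
\<close>

lemma proximal_point_subgradient:
  fixes f :: "real ^ 'd \<Rightarrow> ereal"
  assumes cl: "closed_fun f" and cv: "convex_fun f" and pr: "proper_fun f"
    and lower: "\<And>y. ereal m \<le> f y" and c: "c > 0"
  obtains p where "c *\<^sub>R (x - p) \<in> subdifferential f p"
proof -
  define \<phi> :: "(real ^ 'd) \<times> real \<Rightarrow> real" where "\<phi> q = snd q + c / 2 * (norm (fst q - x))\<^sup>2" for q
  have cont: "continuous_on A \<phi>" for A
    unfolding \<phi>_def by (intro continuous_intros)
  obtain z0 where "f z0 \<noteq> \<infinity>" "f z0 \<noteq> -\<infinity>"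
    using pr unfolding proper_fun_def by blast
  then obtain t0 where t0: "f z0 = ereal t0"
    by (cases "f z0") auto
  define v0 where "v0 = \<phi> (z0, t0)"
  define K where "K = epi f \<inter> {q. \<phi> q \<le> v0}"
  have q0: "(z0, t0) \<in> K"
    using t0 by (simp add: K_def epi_def v0_def)
  have "closed {q. \<phi> q \<le> v0}"
    by (intro closed_Collect_le cont continuous_on_const)
  then have "closed K"
    using cl unfolding K_def closed_fun_def by blast
  moreover have "K \<subseteq> cball x (sqrt (2 * (v0 - m) / c)) \<times> {m..v0}"
  proof
    fix q assume q: "q \<in> K"
    obtain z t where zt: "q = (z, t)" by (cases q)
    have ft: "f z \<le> ereal t" and le: "t + c / 2 * (norm (z - x))\<^sup>2 \<le> v0"
      using q by (auto simp: K_def epi_def \<phi>_def zt)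
    have "m \<le> t"
      using order_trans[OF lower ft] by simp
    have "c * (norm (z - x))\<^sup>2 \<le> 2 * (v0 - m)"
      using le \<open>m \<le> t\<close> by simp
    then have "(norm (z - x))\<^sup>2 \<le> 2 * (v0 - m) / c"
      using c by (simp add: pos_le_divide_eq mult.commute)
    then have "norm (z - x) \<le> sqrt (2 * (v0 - m) / c)"
      by (rule real_le_rsqrt)
    moreover have "0 \<le> c / 2 * (norm (z - x))\<^sup>2"
      using c by simp
    then have "t \<le> v0"
      using le by linarith
    ultimately show "q \<in> cball x (sqrt (2 * (v0 - m) / c)) \<times> {m..v0}"
      using \<open>m \<le> t\<close> by (simp add: zt dist_norm norm_minus_commute)
  qed
  ultimately have "compact K"
    using bounded_subset[OF bounded_Times[OF bounded_cball bounded_closed_interval]]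
    by (auto simp: compact_eq_bounded_closed)
  then obtain q where q: "q \<in> K" and qmin: "\<And>r. r \<in> K \<Longrightarrow> \<phi> q \<le> \<phi> r"
    using continuous_attains_inf[OF _ _ cont, of K] q0 by blast
  obtain p t where pt: "q = (p, t)" by (cases q)
  have pE: "(p, t) \<in> epi f"
    using q by (simp add: K_def pt)
  have min: "\<phi> (p, t) \<le> \<phi> r" if "r \<in> epi f" for r
  proof (cases "\<phi> r \<le> v0")
    case True
    then show ?thesis using qmin[of r] that by (simp add: K_def pt)
  next
    case False
    then show ?thesis using q by (simp add: K_def pt)
  qed
  have key: "t + c * ((x - p) \<bullet> (y - p)) \<le> s" if ys: "(y, s) \<in> epi f" for y s
  proof -
    define B where "B = c / 2 * (norm (y - p))\<^sup>2"
    define A where "A = c * ((x - p) \<bullet> (y - p))"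
    have step: "t + A \<le> s + \<theta> * B" if "0 < \<theta>" "\<theta> \<le> 1" for \<theta> :: real
    proof -
      have "(1 - \<theta>) *\<^sub>R (p, t) + \<theta> *\<^sub>R (y, s) \<in> epi f"
        using cv pE ys that unfolding convex_fun_def by (intro convexD) auto
      then have "\<phi> (p, t) \<le> \<phi> ((1 - \<theta>) *\<^sub>R (p, t) + \<theta> *\<^sub>R (y, s))"
        by (rule min)
      moreover have "(1 - \<theta>) *\<^sub>R p + \<theta> *\<^sub>R y - x = (p - x) + \<theta> *\<^sub>R (y - p)"
        by (simp add: algebra_simps)
      moreover have "(norm ((p - x) + \<theta> *\<^sub>R (y - p)))\<^sup>2
          = (norm (p - x))\<^sup>2 - 2 * \<theta> * ((x - p) \<bullet> (y - p)) + \<theta>\<^sup>2 * (norm (y - p))\<^sup>2"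
        unfolding power2_norm_eq_inner
        by (simp add: algebra_simps inner_commute power2_eq_square)
      ultimately have "t + c / 2 * (norm (p - x))\<^sup>2 \<le> (1 - \<theta>) * t + \<theta> * s
          + c / 2 * ((norm (p - x))\<^sup>2 - 2 * \<theta> * ((x - p) \<bullet> (y - p)) + \<theta>\<^sup>2 * (norm (y - p))\<^sup>2)"
        by (simp add: \<phi>_def)
      then have "\<theta> * (t + A) \<le> \<theta> * (s + \<theta> * B)"
        by (simp add: A_def B_def algebra_simps power2_eq_square)
      then show ?thesis
        using that by simp
    qed
    have "(\<lambda>n. s + inverse (real (Suc n)) * B) \<longlonglongrightarrow> s + 0 * B"
      by (intro tendsto_intros LIMSEQ_inverse_real_of_nat)
    then have "t + A \<le> s + 0 * B"
      by (rule LIMSEQ_le_const) (intro exI[of _ 0] allI impI step, auto simp: field_simps)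
    then show ?thesis by (simp add: A_def)
  qed
  have "c *\<^sub>R (x - p) \<in> subdifferential f p"
    unfolding subdifferential_def
  proof (intro CollectI allI)
    fix y
    show "f p + ereal (c *\<^sub>R (x - p) \<bullet> (y - p)) \<le> f y"
    proof (cases "f y")
      case (real s)
      have "f p \<le> ereal t"
        using pE by (simp add: epi_def)
      then have "f p + ereal (c *\<^sub>R (x - p) \<bullet> (y - p)) \<le> ereal t + ereal (c *\<^sub>R (x - p) \<bullet> (y - p))"
        by (rule add_right_mono)
      also have "\<dots> \<le> ereal s"
        using key[of y s] real by (simp add: epi_def)
      finally show ?thesis by (simp add: real)
    next
      case PInf
      then show ?thesis by simp
    next
      case MInf
      then show ?thesis using pr by (simp add: proper_fun_def)
    qed
  qed
  then show ?thesis by (rule that)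
qed

lemma subdifferential_nonempty:
  fixes f :: "real ^ 'd \<Rightarrow> ereal"
  assumes f: "f \<in> class_C M" and lower: "\<And>y. ereal m \<le> f y"
  shows "subdifferential f x \<noteq> {}"
proof -
  have cl: "closed_fun f" and cv: "convex_fun f" and pr: "proper_fun f"
    and bd: "\<And>x g. g \<in> subdifferential f x \<Longrightarrow> norm g \<le> M"
    using f by (auto simp: class_C_def)
  have "\<exists>p. real (Suc n) *\<^sub>R (x - p) \<in> subdifferential f p" for n
    using proximal_point_subgradient[OF cl cv pr lower, of "real (Suc n)" x] by auto
  then obtain p where p: "\<And>n. real (Suc n) *\<^sub>R (x - p n) \<in> subdifferential f (p n)"
    by metis
  define g where "g n = real (Suc n) *\<^sub>R (x - p n)" for n
  have g: "g n \<in> subdifferential f (p n)" for n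
    using p by (simp add: g_def)
  have px: "p n = x - inverse (real (Suc n)) *\<^sub>R g n" for n
    by (simp add: g_def del: of_nat_Suc)
  have "range g \<subseteq> cball 0 M"
    using bd[OF g] by (auto simp: dist_norm)
  then obtain l r where r: "strict_mono (r :: nat \<Rightarrow> nat)" and l: "(g \<circ> r) \<longlonglongrightarrow> l"
    using compact_cball[of 0 M] unfolding compact_def
    by (meson range_subsetD)
  have inv0: "(\<lambda>n. inverse (real (Suc (r n)))) \<longlonglongrightarrow> 0"
    using LIMSEQ_subseq_LIMSEQ[OF LIMSEQ_inverse_real_of_nat r] by (simp add: o_def)
  have lg: "(\<lambda>n. g (r n)) \<longlonglongrightarrow> l"
    using l by (simp add: o_def)
  have "(\<lambda>n. x - inverse (real (Suc (r n))) *\<^sub>R g (r n)) \<longlonglongrightarrow> x - 0 *\<^sub>R l"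
    by (intro tendsto_intros inv0 lg)
  then have lp: "(\<lambda>n. p (r n)) \<longlonglongrightarrow> x"
    unfolding px[symmetric] by simp
  have "l \<in> subdifferential f x"
    unfolding subdifferential_def
  proof (intro CollectI allI)
    fix y
    show "f x + ereal (l \<bullet> (y - x)) \<le> f y"
    proof (cases "f y")
      case (real s)
      \<comment> \<open>Solved for \<open>f (p n)\<close>, the subgradient inequality at \<open>p n\<close> says that a point lies in the
        epigraph; closedness then applies even though finiteness of \<open>f x\<close> is not yet known.\<close>
      have "(p n, s - g n \<bullet> (y - p n)) \<in> epi f" for n
      proof -
        have "f (p n) + ereal (g n \<bullet> (y - p n)) \<le> ereal s"
          using g[of n] real unfolding subdifferential_def by (metis (mono_tags, lifting) mem_Collect_eq)
        then show ?thesis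
          by (cases "f (p n)") (auto simp: epi_def)
      qed
      then have "\<forall>n. (p (r n), s - g (r n) \<bullet> (y - p (r n))) \<in> epi f" by blast
      moreover have "(\<lambda>n. (p (r n), s - g (r n) \<bullet> (y - p (r n)))) \<longlonglongrightarrow> (x, s - l \<bullet> (y - x))"
        by (intro tendsto_intros lp lg)
      ultimately have "(x, s - l \<bullet> (y - x)) \<in> epi f"
        using cl unfolding closed_fun_def by (meson closed_sequentially)
      then show ?thesis
        by (cases "f x") (auto simp: epi_def real)
    next
      case PInf
      then show ?thesis by simp
    next
      case MInf
      then show ?thesis using pr by (simp add: proper_fun_def)
    qed
  qed
  then show ?thesis by blast
qed

section \<open>The rate\<close>

text \<open>
  The induction step adds the inequality at \<open>x (n + 1)\<close> towards \<open>xs\<close> and \<open>n + 1\<close> times the one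
  towards \<open>x n\<close>. Under the recursion for \<open>x\<close>, their inner products sum to
  \<open>g (n + 1) \<bullet> (xs - x 0 + h S)\<close>, where \<open>S\<close> is the sum of the earlier subgradients, and the term
  \<open>h * (S \<bullet> g (n + 1))\<close> is what expanding the square of \<open>norm (S + g (n + 1))\<close> produces.
  The numbers \<open>F n\<close> stand for the function values and \<open>Fs\<close> for the minimum.
\<close>

lemma averaged_subgradient_telescoping:
  fixes x g :: "nat \<Rightarrow> 'a::real_inner"
  assumes rec: "\<And>i. i < N \<Longrightarrow>
      (real i + 2) *\<^sub>R x (Suc i) = (real i + 1) *\<^sub>R x i + x 0 - h *\<^sub>R (\<Sum>j\<le>i. g j)"
    and star: "\<And>i. i \<le> N \<Longrightarrow> F i + g i \<bullet> (xs - x i) \<le> Fs"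
    and prev: "\<And>i. i < N \<Longrightarrow> F (Suc i) + g (Suc i) \<bullet> (x i - x (Suc i)) \<le> F i"
    and "n \<le> N"
  shows "(real n + 1) * (F n - Fs) \<le> (\<Sum>j\<le>n. g j) \<bullet> (x 0 - xs)
           - h / 2 * (norm (\<Sum>j\<le>n. g j))\<^sup>2 + h / 2 * (\<Sum>j\<le>n. (norm (g j))\<^sup>2)"
  using \<open>n \<le> N\<close>
proof (induction n)
  case 0
  then show ?case using star[of 0] by (simp add: inner_diff_right)
next
  case (Suc n)
  define S where "S = (\<Sum>j\<le>n. g j)"
  define G where "G = g (Suc n)"
  have "(real n + 1) * (F (Suc n) + G \<bullet> (x n - x (Suc n))) \<le> (real n + 1) * F n"
    using prev[of n] Suc.prems by (intro mult_left_mono) (auto simp: G_def)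
  moreover have "F (Suc n) + G \<bullet> (xs - x (Suc n)) \<le> Fs"
    using star Suc.prems by (simp add: G_def)
  moreover have "(real n + 1) * (G \<bullet> (x n - x (Suc n))) + G \<bullet> (xs - x (Suc n))
      = h * (S \<bullet> G) - G \<bullet> (x 0 - xs)"
  proof -
    have "(real n + 1) * (G \<bullet> (x n - x (Suc n))) + G \<bullet> (xs - x (Suc n))
      = G \<bullet> ((real n + 1) *\<^sub>R x n + xs - (real n + 2) *\<^sub>R x (Suc n))"
      by (simp add: algebra_simps)
    also have "(real n + 1) *\<^sub>R x n + xs - (real n + 2) *\<^sub>R x (Suc n) = xs - x 0 + h *\<^sub>R S"
      unfolding S_def by (subst rec) (use Suc.prems in simp_all)
    finally show ?thesis by (simp add: algebra_simps inner_commute)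
  qed
  moreover have "(norm (S + G))\<^sup>2 = (norm S)\<^sup>2 + 2 * (S \<bullet> G) + (norm G)\<^sup>2"
    unfolding power2_norm_eq_inner by (simp add: inner_add inner_commute)
  moreover have "(real n + 1) * (F n - Fs) \<le> S \<bullet> (x 0 - xs)
           - h / 2 * (norm S)\<^sup>2 + h / 2 * (\<Sum>j\<le>n. (norm (g j))\<^sup>2)"
    using Suc unfolding S_def by simp
  ultimately have "(real (Suc n) + 1) * (F (Suc n) - Fs) \<le> (S + G) \<bullet> (x 0 - xs)
           - h / 2 * (norm (S + G))\<^sup>2 + h / 2 * ((\<Sum>j\<le>n. (norm (g j))\<^sup>2) + (norm G)\<^sup>2)"
    by (simp add: inner_add_left algebra_simps)
  then show ?case by (simp add: S_def G_def)
qed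

text \<open>
  The step size makes \<open>R = h c\<close> with \<open>c = M sqrt (N + 1)\<close>, so that after Cauchy-Schwarz the
  terms in \<open>S\<close> are at most \<open>h (c s - s^2 / 2) \<le> h c^2 / 2\<close> with \<open>s = norm S\<close>. As nothing is
  divided by \<open>h\<close>, the case \<open>R = 0\<close> needs no separate treatment.
\<close>

lemma averaged_subgradient_rate:
  fixes x g :: "nat \<Rightarrow> 'a::real_inner"
  assumes M: "M > 0" and R: "R \<ge> 0" and h: "h = R / (M * sqrt (real N + 1))"
    and rec: "\<And>i. i < N \<Longrightarrow>
      (real i + 2) *\<^sub>R x (Suc i) = (real i + 1) *\<^sub>R x i + x 0 - h *\<^sub>R (\<Sum>j\<le>i. g j)"
    and star: "\<And>i. i \<le> N \<Longrightarrow> F i + g i \<bullet> (xs - x i) \<le> Fs"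
    and prev: "\<And>i. i < N \<Longrightarrow> F (Suc i) + g (Suc i) \<bullet> (x i - x (Suc i)) \<le> F i"
    and bound: "\<And>i. i \<le> N \<Longrightarrow> norm (g i) \<le> M"
    and dist: "norm (x 0 - xs) \<le> R"
  shows "F N - Fs \<le> M * R / sqrt (real N + 1)"
proof -
  define S where "S = (\<Sum>j\<le>N. g j)"
  define q where "q = sqrt (real N + 1)"
  define c where "c = M * q"
  have q: "q > 0" "q * q = real N + 1"
    by (auto simp: q_def)
  have c: "c > 0" "R = h * c" "h \<ge> 0"
    using M R q by (auto simp: c_def h q_def[symmetric])
  have "S \<bullet> (x 0 - xs) \<le> norm S * norm (x 0 - xs)"
    by (rule norm_cauchy_schwarz)
  also have "\<dots> \<le> norm S * (h * c)"
    using dist c by (intro mult_left_mono) auto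
  finally have S: "S \<bullet> (x 0 - xs) \<le> norm S * (h * c)" .
  have "(\<Sum>j\<le>N. (norm (g j))\<^sup>2) \<le> (\<Sum>j\<le>N. M\<^sup>2)"
    using bound by (intro sum_mono power_mono) auto
  also have "\<dots> = c\<^sup>2"
    using q(2) by (simp add: c_def power_mult_distrib power2_eq_square algebra_simps)
  finally have "h / 2 * (\<Sum>j\<le>N. (norm (g j))\<^sup>2) \<le> h / 2 * c\<^sup>2"
    using c by (intro mult_left_mono) auto
  moreover have "0 \<le> h / 2 * (norm S - c)\<^sup>2"
    using c by simp
  moreover have "h / 2 * (norm S - c)\<^sup>2 = h / 2 * (norm S)\<^sup>2 - norm S * (h * c) + h / 2 * c\<^sup>2"
    by (simp add: power2_eq_square algebra_simps)
  moreover have "(real N + 1) * (F N - Fs) \<le> S \<bullet> (x 0 - xs)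
           - h / 2 * (norm S)\<^sup>2 + h / 2 * (\<Sum>j\<le>N. (norm (g j))\<^sup>2)"
    unfolding S_def by (rule averaged_subgradient_telescoping[OF rec star prev]) auto
  ultimately have "(real N + 1) * (F N - Fs) \<le> h * c\<^sup>2"
    using S by linarith
  also have "h * c\<^sup>2 = (q * q) * (M * R / q)"
    using q(1) c(2) by (simp add: c_def power2_eq_square)
  finally have "(q * q) * (F N - Fs) \<le> (q * q) * (M * R / q)"
    using q(2) by simp
  then have "F N - Fs \<le> M * R / q"
    by (rule mult_left_le_imp_le) (use q(1) in simp)
  then show ?thesis
    by (simp add: q_def)
qed

theorem corollary3:
  fixes f :: "real ^ 'd \<Rightarrow> ereal"
    and x0 xN :: "real ^ 'd"
    and M R :: real
    and N :: nat
  assumes "M > 0"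
    and "R \<ge> 0"
    and "N \<ge> 1"
    and "C_input M R f x0"
    and "ssep_output M R f x0 N xN"
  shows "f xN - min_value f \<le> ereal (M * R / sqrt (real N + 1))"
proof -
  have fC: "f \<in> class_C M"
    using assms(4) by (simp add: C_input_def)
  then have pr: "proper_fun f" and bd: "\<And>x g. g \<in> subdifferential f x \<Longrightarrow> norm g \<le> M"
    by (auto simp: class_C_def)
  obtain xs where xs: "xs \<in> argmin_set f" "norm (x0 - xs) \<le> R"
    using assms(4) by (auto simp: C_input_def)
  have least: "f xs \<le> f y" for y
    using xs(1) by (auto simp: argmin_set_def is_arg_min_def not_less)
  have fin_xs: "f xs = ereal (real_of_ereal (f xs))"
  proof -
    obtain z where "f z \<noteq> \<infinity>" using pr unfolding proper_fun_def by blast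
    then have "f xs \<noteq> \<infinity>" using least[of z] by auto
    moreover have "f xs \<noteq> -\<infinity>" using pr by (simp add: proper_fun_def)
    ultimately show ?thesis by (cases "f xs") auto
  qed
  have mv: "min_value f = f xs"
    unfolding min_value_def by (rule antisym) (auto intro: INF_lower INF_greatest least)
  have nonempty: "subdifferential f z \<noteq> {}" for z
    using subdifferential_nonempty[OF fC, of "real_of_ereal (f xs)"] least fin_xs by metis
  define F where "F z = real_of_ereal (f z)" for z
  have F: "f z = ereal (F z)" for z
  proof -
    obtain u where "u \<in> subdifferential f z" using nonempty by blast
    then have "f z + ereal (u \<bullet> (xs - z)) \<le> f xs"
      by (simp add: subdifferential_def)
    then have "f z \<noteq> \<infinity>" using fin_xs by (metis ereal_infty_less_eq(1) plus_ereal.simps(2) PInfty_neq_ereal(2))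
    moreover have "f z \<noteq> -\<infinity>" using pr by (simp add: proper_fun_def)
    ultimately show ?thesis by (cases "f z") (auto simp: F_def)
  qed
  have subgrad: "F z + u \<bullet> (y - z) \<le> F y" if "u \<in> subdifferential f z" for u y z
  proof -
    have "f z + ereal (u \<bullet> (y - z)) \<le> f y"
      using that by (simp add: subdifferential_def)
    then show ?thesis by (simp add: F)
  qed
  define h where "h = R / (M * sqrt (real N + 1))"
  obtain x g where run: "ssep_run M R f x0 N x g" and xN: "xN = x N"
    using assms(5) by (auto simp: ssep_output_def)
  have x_0: "x 0 = x0" and g: "\<And>j. j < N \<Longrightarrow> g j \<in> subdifferential f (x j)"
    and step: "\<And>i. i < N \<Longrightarrow> x (Suc i) = (real (Suc i) / (real (Suc i) + 1)) *\<^sub>R x i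
      + (1 / (real (Suc i) + 1)) *\<^sub>R x0 - h *\<^sub>R ((1 / (real (Suc i) + 1)) *\<^sub>R (\<Sum>j<Suc i. g j))"
    using run by (auto simp: ssep_run_def Let_def h_def)
  obtain gN where gN: "gN \<in> subdifferential f (x N)"
    using nonempty by blast
  \<comment> \<open>The run leaves \<open>g N\<close> unconstrained; it is replaced by an actual subgradient at \<open>x N\<close>.\<close>
  define g' where "g' = g(N := gN)"
  have g': "g' j \<in> subdifferential f (x j)" if "j \<le> N" for j
    using that g gN by (cases "j = N") (auto simp: g'_def)
  have "F (x N) - F xs \<le> M * R / sqrt (real N + 1)"
  proof (rule averaged_subgradient_rate[OF assms(1,2) h_def, where x = x and g = g'])
    fix i assume i: "i < N"
    define a where "a = real i + 2"
    have a: "a \<noteq> 0" "real (Suc i) + 1 = a" "real (Suc i) = real i + 1"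
      by (auto simp: a_def)
    have "(\<Sum>j<Suc i. g j) = (\<Sum>j\<le>i. g' j)"
      using i by (intro sum.cong) (auto simp: g'_def)
    then have "x (Suc i) = ((real i + 1) / a) *\<^sub>R x i + (1 / a) *\<^sub>R x 0
        - h *\<^sub>R ((1 / a) *\<^sub>R (\<Sum>j\<le>i. g' j))"
      using step[OF i] unfolding a(2) unfolding a(3) x_0 by simp
    then have "a *\<^sub>R x (Suc i) = (real i + 1) *\<^sub>R x i + x 0 - h *\<^sub>R (\<Sum>j\<le>i. g' j)"
      using a(1) by (simp add: scaleR_add_right scaleR_diff_right)
    then show "(real i + 2) *\<^sub>R x (Suc i) = (real i + 1) *\<^sub>R x i + x 0 - h *\<^sub>R (\<Sum>j\<le>i. g' j)"
      by (simp add: a_def)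
  qed (use g' bd subgrad xs(2) x_0 in auto)
  then show ?thesis
    by (simp add: mv xN F)
qed

end
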